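(* Let $\varphi$ be an $\omega$-regular winning condition and let $\psi_{\neg\varphi}\in\mathcal L^{env}_\mu$ be a closed formula that matches $\varphi$ (i.e., for every GS with winning condition $\varphi$ it evaluates to the environment's winning region). Let $G^w=\langle\mathcal V,\mathcal X,\mathcal Y,\rho^e,\rho^s,\varphi,w^s\rangle$ be a weighted game structure whose winning condition is $\varphi$, and let $c\in\mathbb N$. Then for every state $s\in2^{\mathcal V}$: if $[\![\psi_{\neg\varphi}^E]\!]^{G^w(c)}(s)\neq+\infty$, then $c-[\![\psi_{\neg\varphi}^E]\!]^{G^w(c)}(s)$ is the maximum initial credit for which the environment wins from $s$ w.r.t. $c$ in $G^w$; otherwise, $s$ does not win for the environment w.r.t. $c$ for any initial credit $c_0\in[0,c]$.
   Context: Game structures. A game structure (GS) is $G=\langle\mathcal V,\mathcal X,\mathcal Y,\rho^e,\rho^s,\varphi\rangle$: $\mathcal V$ finite set of Boolean variables, $\mathcal X\subseteq\mathcal V$ inputs (environment), $\mathcal Y=\mathcal V\setminus\mathcal X$ outputs (system). States are $s\in2^{\mathcal V}$; $p(s)$ is the copy over primed variables $\mathcal V'$; assignments to disjoint variable sets are combined by union and written as tuples. $\rho^e$ is a propositional formula over $\mathcal V\cup\mathcal X'$, $\rho^s$ over $\mathcal V\cup\mathcal V'$, $\varphi$ an $\omega$-regular condition. In each round from $s$ the environment picks $s_{\mathcal X}$ with $(s,p(s_{\mathcal X}))\models\rho^e$, then the system picks $s_{\mathcal Y}$ with $(s,p(s_{\mathcal X}),p(s_{\mathcal Y}))\models\rho^s$;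 next state $(s_{\mathcal X},s_{\mathcal Y})$. Plays are infinite or finite ending in a deadlock for the environment (no valid input) or for the system (valid input chosen, no valid output). A play wins for the system qualitatively if it ends in an environment deadlock or is infinite and satisfies $\varphi$. Strategies for both players, consistency, and strategies "from $s$" are as usual. WGS and energy. A WGS adds a partial weight function $w^s:2^{\mathcal V\cup\mathcal V'}\to\mathbb Z$ on $\rho^s$-transitions. For $c\in\mathbb N\cup\{+\infty\}$ and $c_0\in\mathbb N$, $c_0\le c$, the energy level of $s_0\ldots s_k$ is $r_k$, $r_0=c_0$, $r_i=\min(c,r_{i-1}+w^s(s_{i-1},p(s_i)))$. A play wins the $\varphi$-energy objective w.r.t. $c$ for $c_0$ if it wins qualitatively for the system and all prefixes have non-negative energy level. An environment strategy wins from $s$ w.r.t. $c$ for $c_0$ if it is a strategy from $s$ and no consistent play from $s$ wins the $\varphi$-energy objective w.r.t. $c$ for $c_0$; the environment wins from $s$ w.r.t. $c$ for $c_0$ if such a strategy exists. $\mu$-calculus. $\psi::=v\mid\neg v\mid X\mid\psi\vee\psi\mid\psi\wedge\psi\mid\Diamond\psi\mid\Box\psi\mid\mu X\psi\mid\nu X\psi$, with set semantics over a GS: literals, union, intersection, least/greatest fixed points standard; $[\![\Diamond\phi]\!]$: states $s$ such that every valid input has a valid output leading into $[\![\phi]\!]$; $[\![\Box\phi]\!]$: states $s$ with some valid input all of whose valid outputs lead into $[\![\phi]\!]$. $\mathcal L^{env}_\mu$ is the set of formulas with no $\Diamond$. Energy $\mu$-calculus. $\psi^E$ replaces $\Diamond,\Box$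 by $\Diamond_E,\Box_E$. For $c\in\mathbb N$, $E(c)=\{0,\ldots,c\}\cup\{+\infty\}$, $EF(c)$ = functions $2^{\mathcal V}\to E(c)$, $f_x$ constant $x$. $EC_c((s,s'),e)$: $0$ if $(s,s')\not\models\rho^e$; else $+\infty$ if $e=+\infty$ or $(s,s')\models\neg\rho^s$; else $+\infty$ if $e-w^s(s,s')>c$; else $\max(0,e-w^s(s,s'))$. $ECpre_{sys}(f)(s)=\max_{s_{\mathcal X}}\min_{s_{\mathcal Y}}EC_c((s,p(s_{\mathcal X},s_{\mathcal Y})),f(s_{\mathcal X},s_{\mathcal Y}))$. Negation $\sim0=+\infty$, $\sim(+\infty)=0$, $\sim x=c+1-x$ otherwise, pointwise on $EF(c)$. Semantics $[\![\cdot]\!]^{G^w(c)}_{\mathcal D}\in EF(c)$: $[\![v]\!](s)=0$ if $s\models v$, else $+\infty$; $[\![\neg v]\!](s)=+\infty$ if $s\models v$, else $0$; $[\![X]\!]=\mathcal D(X)$; $\vee$ pointwise min; $\wedge$ pointwise max; $[\![\Diamond_E\phi]\!]=ECpre_{sys}([\![\phi]\!])$; $[\![\Box_E\phi]\!]=\sim ECpre_{sys}(\sim[\![\phi]\!])$; $[\![\mu X\phi]\!]=\min_i h_i$ with $h_0=f_{+\infty}$, $h_{i+1}=[\![\phi]\!]_{\mathcal D[X\mapsto h_i]}$; $[\![\nu X\phi]\!]=\max_ih_i$ with $h_0=f_0$. *)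

theory Defs
  imports
    Complex_Main
    "HOL-Library.Extended_Nat"
    "HOL-Library.Infinite_Set"
    "HOL-Library.Infinite_Typeclass"
begin

section \<open>Propositional formulas and omega-regular conditions\<close>

datatype (pvars: 'a) pform =
    PConst bool
  | PVar 'a
  | PNot "'a pform"
  | PAnd "'a pform" "'a pform"
  | POr "'a pform" "'a pform"

primrec psat :: "'a set \<Rightarrow> 'a pform \<Rightarrow> bool" where
  "psat A (PConst b) \<longleftrightarrow> b"
| "psat A (PVar a) \<longleftrightarrow> a \<in> A"
| "psat A (PNot f) \<longleftrightarrow> \<not> psat A f"
| "psat A (PAnd f g) \<longleftrightarrow> psat A f \<and> psat A g"
| "psat A (POr f g) \<longleftrightarrow> psat A f \<or> psat A g"

text \<open>\<open>Cur v\<close> is the variable \<open>v\<close> itself and \<open>Nxt v\<close> its primed copy \<open>v'\<close>.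
  Assignments are sets of variables (those that are true), and \<open>with_primed s t\<close> is
  the assignment \<open>(s, p(t))\<close>.\<close>

datatype 'v pvar = Cur 'v | Nxt 'v

definition with_primed :: "'v set \<Rightarrow> 'v set \<Rightarrow> 'v pvar set" where
  "with_primed s t = Cur ` s \<union> Nxt ` t"

text \<open>A winning condition is a set of infinite words whose letters are sets of variables.
  It is omega-regular over a set \<open>V\<close> of variables if it is recognized by a finite
  nondeterministic Buechi automaton that reads letters from \<open>2\<^sup>V\<close>; other
  variables in a letter are ignored. Hence a condition over \<open>V\<close> is also a condition over
  every larger set of variables, so the same condition can be used in game
  structures over different sets of variables.\<close>

definition buchi_accepts ::
  "nat set \<Rightarrow> (nat \<times> 'a \<times> nat) set \<Rightarrow> nat set \<Rightarrow> (nat \<Rightarrow> 'a) \<Rightarrow> bool" where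
  "buchi_accepts I \<delta> F w \<longleftrightarrow>
     (\<exists>r. r 0 \<in> I \<and> (\<forall>i. (r i, w i, r (Suc i)) \<in> \<delta>) \<and> (\<exists>\<^sub>\<infinity>i. r i \<in> F))"

definition omega_regular_over :: "'v set \<Rightarrow> (nat \<Rightarrow> 'v set) set \<Rightarrow> bool" where
  "omega_regular_over V \<phi> \<longleftrightarrow>
     (\<exists>(Q :: nat set) I \<delta> F. finite Q \<and> I \<subseteq> Q \<and> F \<subseteq> Q \<and> \<delta> \<subseteq> Q \<times> Pow V \<times> Q \<and>
        (\<forall>w. w \<in> \<phi> \<longleftrightarrow> buchi_accepts I \<delta> F (\<lambda>i. w i \<inter> V)))"

definition omega_regular :: "(nat \<Rightarrow> 'v set) set \<Rightarrow> bool" where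
  "omega_regular \<phi> \<longleftrightarrow> (\<exists>V. finite V \<and> omega_regular_over V \<phi>)"


section \<open>Game structures and weighted game structures\<close>

record 'v gs =
  vars :: "'v set"
  inputs :: "'v set"
  rho_e :: "'v pvar pform"
  rho_s :: "'v pvar pform"
  win_cond :: "(nat \<Rightarrow> 'v set) set"

text \<open>The weight function is partial, being defined on the transitions that satisfy
  \<open>rho_s\<close>. It is totalized here; all uses below are guarded by \<open>rho_s\<close>,
  so the values elsewhere are irrelevant.\<close>

record 'v wgs = "'v gs" +
  weight :: "'v set \<Rightarrow> 'v set \<Rightarrow> int"

definition outputs :: "('v, 'm) gs_scheme \<Rightarrow> 'v set" where
  "outputs G = vars G - inputs G"

definition states :: "('v, 'm) gs_scheme \<Rightarrow> 'v set set" where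
  "states G = Pow (vars G)"

definition game_structure :: "('v, 'm) gs_scheme \<Rightarrow> bool" where
  "game_structure G \<longleftrightarrow>
     finite (vars G) \<and> inputs G \<subseteq> vars G \<and>
     pvars (rho_e G) \<subseteq> Cur ` vars G \<union> Nxt ` inputs G \<and>
     pvars (rho_s G) \<subseteq> Cur ` vars G \<union> Nxt ` vars G \<and>
     omega_regular_over (vars G) (win_cond G)"

definition valid_input :: "('v, 'm) gs_scheme \<Rightarrow> 'v set \<Rightarrow> 'v set \<Rightarrow> bool" where
  "valid_input G s x \<longleftrightarrow> x \<subseteq> inputs G \<and> psat (with_primed s x) (rho_e G)"

definition valid_output :: "('v, 'm) gs_scheme \<Rightarrow> 'v set \<Rightarrow> 'v set \<Rightarrow> 'v set \<Rightarrow> bool" where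
  "valid_output G s x y \<longleftrightarrow> y \<subseteq> outputs G \<and> psat (with_primed s (x \<union> y)) (rho_s G)"

definition step :: "('v, 'm) gs_scheme \<Rightarrow> 'v set \<Rightarrow> 'v set \<Rightarrow> bool" where
  "step G s t \<longleftrightarrow> (\<exists>x y. valid_input G s x \<and> valid_output G s x y \<and> t = x \<union> y)"


section \<open>Plays and environment strategies\<close>

text \<open>A finite play carries its states and the player that deadlocks. A system deadlock also
  records the valid input of the environment to which there is no valid output, since the
  deadlock depends on this choice.\<close>

datatype 'v play =
    Infinite "nat \<Rightarrow> 'v set"
  | EnvDeadlock "'v set list"
  | SysDeadlock "'v set list" "'v set"

primrec state_at :: "'v play \<Rightarrow> nat \<Rightarrow> 'v set" where
  "state_at (Infinite \<sigma>) i = \<sigma> i"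
| "state_at (EnvDeadlock \<pi>) i = \<pi> ! i"
| "state_at (SysDeadlock \<pi> x) i = \<pi> ! i"

primrec play_length :: "'v play \<Rightarrow> enat" where
  "play_length (Infinite \<sigma>) = \<infinity>"
| "play_length (EnvDeadlock \<pi>) = enat (length \<pi>)"
| "play_length (SysDeadlock \<pi> x) = enat (length \<pi>)"

primrec proper_end :: "('v, 'm) gs_scheme \<Rightarrow> 'v play \<Rightarrow> bool" where
  "proper_end G (Infinite \<sigma>) \<longleftrightarrow> True"
| "proper_end G (EnvDeadlock \<pi>) \<longleftrightarrow> (\<nexists>x. valid_input G (last \<pi>) x)"
| "proper_end G (SysDeadlock \<pi> x) \<longleftrightarrow>
     valid_input G (last \<pi>) x \<and> (\<nexists>y. valid_output G (last \<pi>) x y)"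

definition play_from :: "('v, 'm) gs_scheme \<Rightarrow> 'v set \<Rightarrow> 'v play \<Rightarrow> bool" where
  "play_from G s p \<longleftrightarrow>
     s \<in> states G \<and> 0 < play_length p \<and> state_at p 0 = s \<and>
     (\<forall>i. enat (Suc i) < play_length p \<longrightarrow> step G (state_at p i) (state_at p (Suc i))) \<and>
     proper_end G p"

text \<open>An environment strategy maps each nonempty list of states to the next input.
  It is a total function of which only the values on consistent prefixes
  that do not end in a deadlock for the environment matter.\<close>

type_synonym 'v env_strategy = "'v set list \<Rightarrow> 'v set"

definition consistent_prefix ::
  "('v, 'm) gs_scheme \<Rightarrow> 'v env_strategy \<Rightarrow> 'v set \<Rightarrow> 'v set list \<Rightarrow> bool" where
  "consistent_prefix G g s \<pi> \<longleftrightarrow>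
     \<pi> \<noteq> [] \<and> hd \<pi> = s \<and>
     (\<forall>i. Suc i < length \<pi> \<longrightarrow>
        step G (\<pi> ! i) (\<pi> ! Suc i) \<and> \<pi> ! Suc i \<inter> inputs G = g (take (Suc i) \<pi>))"

definition env_strategy_from ::
  "('v, 'm) gs_scheme \<Rightarrow> 'v set \<Rightarrow> 'v env_strategy \<Rightarrow> bool" where
  "env_strategy_from G s g \<longleftrightarrow>
     (\<forall>\<pi>. consistent_prefix G g s \<pi> \<and> (\<exists>x. valid_input G (last \<pi>) x) \<longrightarrow>
        valid_input G (last \<pi>) (g \<pi>))"

primrec consistent_end :: "'v env_strategy \<Rightarrow> 'v play \<Rightarrow> bool" where
  "consistent_end g (Infinite \<sigma>) \<longleftrightarrow> True"
| "consistent_end g (EnvDeadlock \<pi>) \<longleftrightarrow> True"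
| "consistent_end g (SysDeadlock \<pi> x) \<longleftrightarrow> x = g \<pi>"

definition consistent :: "('v, 'm) gs_scheme \<Rightarrow> 'v env_strategy \<Rightarrow> 'v play \<Rightarrow> bool" where
  "consistent G g p \<longleftrightarrow>
     (\<forall>i. enat (Suc i) < play_length p \<longrightarrow>
        state_at p (Suc i) \<inter> inputs G = g (map (state_at p) [0..<Suc i])) \<and>
     consistent_end g p"

primrec sys_wins_play :: "('v, 'm) gs_scheme \<Rightarrow> 'v play \<Rightarrow> bool" where
  "sys_wins_play G (Infinite \<sigma>) \<longleftrightarrow> \<sigma> \<in> win_cond G"
| "sys_wins_play G (EnvDeadlock \<pi>) \<longleftrightarrow> True"
| "sys_wins_play G (SysDeadlock \<pi> x) \<longleftrightarrow> False"

definition env_winning_region :: "('v, 'm) gs_scheme \<Rightarrow> 'v set set" where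
  "env_winning_region G =
     {s \<in> states G. \<exists>g. env_strategy_from G s g \<and>
        (\<forall>p. play_from G s p \<and> consistent G g p \<longrightarrow> \<not> sys_wins_play G p)}"


section \<open>Energy objectives\<close>

primrec cap :: "int \<Rightarrow> enat \<Rightarrow> int" where
  "cap r (enat c) = min (int c) r"
| "cap r \<infinity> = r"

primrec energy_level :: "'v wgs \<Rightarrow> enat \<Rightarrow> nat \<Rightarrow> (nat \<Rightarrow> 'v set) \<Rightarrow> nat \<Rightarrow> int" where
  "energy_level G c c\<^sub>0 \<sigma> 0 = int c\<^sub>0"
| "energy_level G c c\<^sub>0 \<sigma> (Suc i) =
     cap (energy_level G c c\<^sub>0 \<sigma> i + weight G (\<sigma> i) (\<sigma> (Suc i))) c"

definition wins_energy :: "'v wgs \<Rightarrow> enat \<Rightarrow> nat \<Rightarrow> 'v play \<Rightarrow> bool" where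
  "wins_energy G c c\<^sub>0 p \<longleftrightarrow>
     sys_wins_play G p \<and>
     (\<forall>k. enat k < play_length p \<longrightarrow> 0 \<le> energy_level G c c\<^sub>0 (state_at p) k)"

text \<open>Meaningful for \<open>s \<in> states G\<close> and \<open>c\<^sub>0 \<le> c\<close>.\<close>

definition env_wins_energy :: "'v wgs \<Rightarrow> 'v set \<Rightarrow> enat \<Rightarrow> nat \<Rightarrow> bool" where
  "env_wins_energy G s c c\<^sub>0 \<longleftrightarrow>
     (\<exists>g. env_strategy_from G s g \<and>
        (\<forall>p. play_from G s p \<and> consistent G g p \<longrightarrow> \<not> wins_energy G c c\<^sub>0 p))"


section \<open>The \<open>\<mu>\<close>-calculus over game structures\<close>

datatype ('v, 'r) mu =
    Lit 'v
  | NLit 'v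
  | RVar 'r
  | Or "('v, 'r) mu" "('v, 'r) mu"
  | And "('v, 'r) mu" "('v, 'r) mu"
  | Dia "('v, 'r) mu"
  | Box "('v, 'r) mu"
  | Mu 'r "('v, 'r) mu"
  | Nu 'r "('v, 'r) mu"

primrec mu_lits :: "('v, 'r) mu \<Rightarrow> 'v set" where
  "mu_lits (Lit v) = {v}"
| "mu_lits (NLit v) = {v}"
| "mu_lits (RVar X) = {}"
| "mu_lits (Or \<phi> \<psi>) = mu_lits \<phi> \<union> mu_lits \<psi>"
| "mu_lits (And \<phi> \<psi>) = mu_lits \<phi> \<union> mu_lits \<psi>"
| "mu_lits (Dia \<phi>) = mu_lits \<phi>"
| "mu_lits (Box \<phi>) = mu_lits \<phi>"
| "mu_lits (Mu X \<phi>) = mu_lits \<phi>"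
| "mu_lits (Nu X \<phi>) = mu_lits \<phi>"

primrec mu_free :: "('v, 'r) mu \<Rightarrow> 'r set" where
  "mu_free (Lit v) = {}"
| "mu_free (NLit v) = {}"
| "mu_free (RVar X) = {X}"
| "mu_free (Or \<phi> \<psi>) = mu_free \<phi> \<union> mu_free \<psi>"
| "mu_free (And \<phi> \<psi>) = mu_free \<phi> \<union> mu_free \<psi>"
| "mu_free (Dia \<phi>) = mu_free \<phi>"
| "mu_free (Box \<phi>) = mu_free \<phi>"
| "mu_free (Mu X \<phi>) = mu_free \<phi> - {X}"
| "mu_free (Nu X \<phi>) = mu_free \<phi> - {X}"

definition mu_closed :: "('v, 'r) mu \<Rightarrow> bool" where
  "mu_closed \<psi> \<longleftrightarrow> mu_free \<psi> = {}"

primrec in_L_env :: "('v, 'r) mu \<Rightarrow> bool" where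
  "in_L_env (Lit v) \<longleftrightarrow> True"
| "in_L_env (NLit v) \<longleftrightarrow> True"
| "in_L_env (RVar X) \<longleftrightarrow> True"
| "in_L_env (Or \<phi> \<psi>) \<longleftrightarrow> in_L_env \<phi> \<and> in_L_env \<psi>"
| "in_L_env (And \<phi> \<psi>) \<longleftrightarrow> in_L_env \<phi> \<and> in_L_env \<psi>"
| "in_L_env (Dia \<phi>) \<longleftrightarrow> False"
| "in_L_env (Box \<phi>) \<longleftrightarrow> in_L_env \<phi>"
| "in_L_env (Mu X \<phi>) \<longleftrightarrow> in_L_env \<phi>"
| "in_L_env (Nu X \<phi>) \<longleftrightarrow> in_L_env \<phi>"

text \<open>Fixed points are taken in the lattice of subsets of \<open>states G\<close>, hence the
  intersections.\<close>

primrec mu_sem ::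
  "('v, 'm) gs_scheme \<Rightarrow> ('v, 'r) mu \<Rightarrow> ('r \<Rightarrow> 'v set set) \<Rightarrow> 'v set set" where
  "mu_sem G (Lit v) D = {s \<in> states G. v \<in> s}"
| "mu_sem G (NLit v) D = {s \<in> states G. v \<notin> s}"
| "mu_sem G (RVar X) D = D X"
| "mu_sem G (Or \<phi> \<psi>) D = mu_sem G \<phi> D \<union> mu_sem G \<psi> D"
| "mu_sem G (And \<phi> \<psi>) D = mu_sem G \<phi> D \<inter> mu_sem G \<psi> D"
| "mu_sem G (Dia \<phi>) D =
     {s \<in> states G. \<forall>x. valid_input G s x \<longrightarrow>
        (\<exists>y. valid_output G s x y \<and> x \<union> y \<in> mu_sem G \<phi> D)}"
| "mu_sem G (Box \<phi>) D =
     {s \<in> states G. \<exists>x. valid_input G s x \<and>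
        (\<forall>y. valid_output G s x y \<longrightarrow> x \<union> y \<in> mu_sem G \<phi> D)}"
| "mu_sem G (Mu X \<phi>) D = lfp (\<lambda>S. states G \<inter> mu_sem G \<phi> (D(X := S)))"
| "mu_sem G (Nu X \<phi>) D = gfp (\<lambda>S. states G \<inter> mu_sem G \<phi> (D(X := S)))"

text \<open>The quantifier ranges over the game structures with winning condition \<open>\<phi>\<close> whose
  variables include those of \<open>\<psi>\<close>; their sets of variables may be arbitrarily large
  finite sets when the type of variable names is infinite. The valuation is irrelevant for
  closed \<open>\<psi>\<close>.\<close>

definition env_matches :: "('v, 'r) mu \<Rightarrow> (nat \<Rightarrow> 'v set) set \<Rightarrow> bool" where
  "env_matches \<psi> \<phi> \<longleftrightarrow>
     (\<forall>G :: 'v gs. game_structure G \<and> win_cond G = \<phi> \<and> mu_lits \<psi> \<subseteq> vars G \<longrightarrow>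
        mu_sem G \<psi> (\<lambda>_. {}) = env_winning_region G)"


section \<open>The energy \<open>\<mu>\<close>-calculus\<close>

datatype ('v, 'r) emu =
    ELit 'v
  | ENLit 'v
  | ERVar 'r
  | EOr "('v, 'r) emu" "('v, 'r) emu"
  | EAnd "('v, 'r) emu" "('v, 'r) emu"
  | EDia "('v, 'r) emu"
  | EBox "('v, 'r) emu"
  | EMu 'r "('v, 'r) emu"
  | ENu 'r "('v, 'r) emu"

primrec to_energy :: "('v, 'r) mu \<Rightarrow> ('v, 'r) emu" where
  "to_energy (Lit v) = ELit v"
| "to_energy (NLit v) = ENLit v"
| "to_energy (RVar X) = ERVar X"
| "to_energy (Or \<phi> \<psi>) = EOr (to_energy \<phi>) (to_energy \<psi>)"
| "to_energy (And \<phi> \<psi>) = EAnd (to_energy \<phi>) (to_energy \<psi>)"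
| "to_energy (Dia \<phi>) = EDia (to_energy \<phi>)"
| "to_energy (Box \<phi>) = EBox (to_energy \<phi>)"
| "to_energy (Mu X \<phi>) = EMu X (to_energy \<phi>)"
| "to_energy (Nu X \<phi>) = ENu X (to_energy \<phi>)"

text \<open>Elements of \<open>EF(c)\<close> are represented by functions into \<^typ>\<open>enat\<close>; only
  their values on states of the game structure, which lie in
  \<open>E(c) = {0, \<dots>, c} \<union> {\<infinity>}\<close>, matter.\<close>

definition EC :: "'v wgs \<Rightarrow> nat \<Rightarrow> 'v set \<Rightarrow> 'v set \<Rightarrow> enat \<Rightarrow> enat" where
  "EC G c s t e =
     (if \<not> psat (with_primed s (t \<inter> inputs G)) (rho_e G) then 0
      else if e = \<infinity> \<or> \<not> psat (with_primed s t) (rho_s G) then \<infinity>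
      else if int (the_enat e) - weight G s t > int c then \<infinity>
      else enat (nat (max 0 (int (the_enat e) - weight G s t))))"

definition ECpre_sys :: "'v wgs \<Rightarrow> nat \<Rightarrow> ('v set \<Rightarrow> enat) \<Rightarrow> 'v set \<Rightarrow> enat" where
  "ECpre_sys G c f s =
     (MAX x \<in> Pow (inputs G). MIN y \<in> Pow (outputs G). EC G c s (x \<union> y) (f (x \<union> y)))"

definition eneg :: "nat \<Rightarrow> enat \<Rightarrow> enat" where
  "eneg c e = (if e = 0 then \<infinity> else if e = \<infinity> then 0 else enat (c + 1) - e)"

text \<open>The infima and suprema over all iterates are attained: those of a sequence in
  \<open>E(c)\<close> are its minimum and maximum.\<close>

primrec emu_sem ::
  "'v wgs \<Rightarrow> nat \<Rightarrow> ('v, 'r) emu \<Rightarrow> ('r \<Rightarrow> 'v set \<Rightarrow> enat) \<Rightarrow> 'v set \<Rightarrow> enat" where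
  "emu_sem G c (ELit v) D = (\<lambda>s. if v \<in> s then 0 else \<infinity>)"
| "emu_sem G c (ENLit v) D = (\<lambda>s. if v \<in> s then \<infinity> else 0)"
| "emu_sem G c (ERVar X) D = D X"
| "emu_sem G c (EOr \<phi> \<psi>) D = (\<lambda>s. min (emu_sem G c \<phi> D s) (emu_sem G c \<psi> D s))"
| "emu_sem G c (EAnd \<phi> \<psi>) D = (\<lambda>s. max (emu_sem G c \<phi> D s) (emu_sem G c \<psi> D s))"
| "emu_sem G c (EDia \<phi>) D = ECpre_sys G c (emu_sem G c \<phi> D)"
| "emu_sem G c (EBox \<phi>) D =
     (\<lambda>s. eneg c (ECpre_sys G c (\<lambda>t. eneg c (emu_sem G c \<phi> D t)) s))"
| "emu_sem G c (EMu X \<phi>) D =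
     (\<lambda>s. INF i. ((\<lambda>h. emu_sem G c \<phi> (D(X := h))) ^^ i) (\<lambda>_. \<infinity>) s)"
| "emu_sem G c (ENu X \<phi>) D =
     (\<lambda>s. SUP i. ((\<lambda>h. emu_sem G c \<phi> (D(X := h))) ^^ i) (\<lambda>_. 0) s)"

end

theory Submission
  imports Defs
begin

text \<open>The energy level is moved into the state: with a set \<open>U\<close> of \<open>c\<close> fresh output variables, a
  state \<open>t\<close> of the unfolded game \<open>H\<close> stands for the state \<open>t \<inter> vars G\<close> at energy level
  \<open>card (t \<inter> U)\<close>, and transitions that would make the energy negative are deleted. Strategies
  transfer between \<open>G\<close> and \<open>H\<close>, a play losing by energy becoming a system deadlock. By
  induction on \<open>\<psi>\<close>, a state \<open>t\<close> of \<open>H\<close> satisfies \<open>\<psi>\<close> iff the value of \<open>\<psi>\<^sup>E\<close> at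
  \<open>t \<inter> vars G\<close> plus the energy level of \<open>t\<close> is at most \<open>c\<close>. Since \<open>\<psi>\<close> computes the
  winning region of \<open>H\<close>, the theorem follows.\<close>

section \<open>Propositional formulas and omega-regular conditions\<close>

lemma psat_cong:
  assumes "A \<inter> pvars f = B \<inter> pvars f"
  shows "psat A f \<longleftrightarrow> psat B f"
proof -
  have "\<forall>a \<in> pvars f. a \<in> A \<longleftrightarrow> a \<in> B"
    using assms by blast
  then show ?thesis by (induction f) auto
qed

text \<open>Shannon expansion on one variable after another. It is needed because the transition
  relation of the unfolded game is given by integer arithmetic and cardinalities, while
  \<open>rho_s\<close> has to be a formula.\<close>

lemma functional_completeness:
  fixes P :: "'a set \<Rightarrow> bool"
  assumes "finite A"
  shows "\<exists>f. pvars f \<subseteq> A \<and> (\<forall>B. psat B f \<longleftrightarrow> P (B \<inter> A))"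
  using assms
proof (induction A arbitrary: P rule: finite_induct)
  case empty
  show ?case by (rule exI[of _ "PConst (P {})"]) auto
next
  case (insert a A)
  obtain f g where f: "pvars f \<subseteq> A" "\<And>B. psat B f \<longleftrightarrow> P (insert a (B \<inter> A))"
    and g: "pvars g \<subseteq> A" "\<And>B. psat B g \<longleftrightarrow> P (B \<inter> A)"
    using insert.IH[of "\<lambda>B. P (insert a B)"] insert.IH[of P] by blast
  let ?h = "POr (PAnd (PVar a) f) (PAnd (PNot (PVar a)) g)"
  have "psat B ?h \<longleftrightarrow> P (B \<inter> insert a A)" for B
    using f(2) g(2) by (cases "a \<in> B") (auto simp: Int_insert_right)
  moreover have "pvars ?h \<subseteq> insert a A"
    using f(1) g(1) by auto
  ultimately show ?case by blast
qed

text \<open>The automaton reads only \<open>w i \<inter> V\<close>. This moves winning runs between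
  \<open>G\<close> and \<open>H\<close>, whose states differ only outside
  \<open>vars G\<close>.\<close>

lemma omega_regular_over_restrict:
  assumes "omega_regular_over V \<phi>"
  shows "w \<in> \<phi> \<longleftrightarrow> (\<lambda>i. w i \<inter> V) \<in> \<phi>"
  using assms unfolding omega_regular_over_def by (auto simp: Int_assoc)

text \<open>Each transition is copied for all letters over \<open>W\<close> with the same trace on
  \<open>V\<close>. It makes the condition of \<open>G\<close> admissible for
  \<open>H\<close>.\<close>

lemma omega_regular_over_mono:
  assumes "omega_regular_over V \<phi>" "V \<subseteq> W"
  shows "omega_regular_over W \<phi>"
proof -
  obtain Q :: "nat set" and I \<delta> F where Q: "finite Q" "I \<subseteq> Q" "F \<subseteq> Q" "\<delta> \<subseteq> Q \<times> Pow V \<times> Q"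
    and acc: "\<And>w. w \<in> \<phi> \<longleftrightarrow> buchi_accepts I \<delta> F (\<lambda>i. w i \<inter> V)"
    using assms(1) unfolding omega_regular_over_def by blast
  define \<delta>' where "\<delta>' = {(q, a, q'). a \<subseteq> W \<and> (q, a \<inter> V, q') \<in> \<delta>}"
  have "w i \<inter> W \<inter> V = w i \<inter> V" for w :: "nat \<Rightarrow> 'a set" and i
    using assms(2) by blast
  then have "w \<in> \<phi> \<longleftrightarrow> buchi_accepts I \<delta>' F (\<lambda>i. w i \<inter> W)" for w
    unfolding acc buchi_accepts_def \<delta>'_def by simp
  moreover have "\<delta>' \<subseteq> Q \<times> Pow W \<times> Q"
    using Q(4) unfolding \<delta>'_def by blast
  ultimately show ?thesis
    unfolding omega_regular_over_def using Q(1-3) by blast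
qed

section \<open>Steps, consistent prefixes, energy levels and transfer of plays\<close>

lemma step_iff:
  assumes "inputs G \<subseteq> vars G"
  shows "step G s t \<longleftrightarrow> t \<subseteq> vars G \<and> valid_input G s (t \<inter> inputs G) \<and>
    psat (with_primed s t) (rho_s G)"
proof
  assume "step G s t"
  then obtain x y where xy: "valid_input G s x" "valid_output G s x y" "t = x \<union> y"
    unfolding step_def by blast
  then have "t \<inter> inputs G = x"
    unfolding valid_input_def valid_output_def outputs_def by blast
  with xy show "t \<subseteq> vars G \<and> valid_input G s (t \<inter> inputs G) \<and> psat (with_primed s t) (rho_s G)"
    using assms unfolding valid_input_def valid_output_def outputs_def by auto
next
  assume *: "t \<subseteq> vars G \<and> valid_input G s (t \<inter> inputs G) \<and> psat (with_primed s t) (rho_s G)"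
  have "t = (t \<inter> inputs G) \<union> (t - inputs G)" by blast
  with * show "step G s t"
    unfolding step_def valid_output_def outputs_def
    by (intro exI[of _ "t \<inter> inputs G"] exI[of _ "t - inputs G"]) auto
qed

lemma consistent_prefix_snoc:
  assumes "consistent_prefix G g s \<pi>" "step G (last \<pi>) t" "t \<inter> inputs G = g \<pi>"
  shows "consistent_prefix G g s (\<pi> @ [t])"
proof -
  have "step G ((\<pi> @ [t]) ! i) ((\<pi> @ [t]) ! Suc i) \<and>
      (\<pi> @ [t]) ! Suc i \<inter> inputs G = g (take (Suc i) (\<pi> @ [t]))" if "Suc i < length (\<pi> @ [t])" for i
  proof (cases "Suc i < length \<pi>")
    case True
    then show ?thesis
      using assms(1) unfolding consistent_prefix_def by (simp add: nth_append)
  next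
    case False
    then have len: "length \<pi> = Suc i" using that by auto
    then have "\<pi> ! i = last \<pi>"
      by (subst last_conv_nth) auto
    with len show ?thesis using assms(2,3) by (simp add: nth_append)
  qed
  then show ?thesis
    using assms(1) unfolding consistent_prefix_def by simp
qed

lemma energy_level_cong:
  assumes "\<And>j. j \<le> i \<Longrightarrow> \<sigma> j = \<tau> j"
  shows "energy_level G c c\<^sub>0 \<sigma> i = energy_level G c c\<^sub>0 \<tau> i"
  using assms by (induction i) auto

lemma energy_level_le:
  assumes "c\<^sub>0 \<le> c"
  shows "energy_level G (enat c) c\<^sub>0 \<sigma> i \<le> int c"
  using assms by (cases i) auto

text \<open>Serves both directions of the strategy transfer: \<open>q\<close> is
  \<open>\<sigma>\<close> cut to the length of \<open>p\<close>. A play won by the system is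
  infinite or ends in an environment deadlock, so agreement on the existence of valid inputs is
  enough to end \<open>q\<close> properly.\<close>

lemma sys_wins_play_transfer:
  fixes G :: "('v, 'm) gs_scheme" and H :: "('v, 'n) gs_scheme"
  assumes p: "play_from G s p" "sys_wins_play G p"
    and "t \<in> states H" "\<sigma> 0 = t"
    and steps: "\<And>i. enat (Suc i) < play_length p \<Longrightarrow> step H (\<sigma> i) (\<sigma> (Suc i))"
    and inp: "\<And>i. enat i < play_length p \<Longrightarrow>
      (\<exists>x. valid_input H (\<sigma> i) x) \<longleftrightarrow> (\<exists>x. valid_input G (state_at p i) x)"
    and win: "play_length p = \<infinity> \<Longrightarrow> state_at p \<in> win_cond G \<Longrightarrow> \<sigma> \<in> win_cond H"
    and cons: "\<And>i. enat (Suc i) < play_length p \<Longrightarrow>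
      \<sigma> (Suc i) \<inter> inputs H = g (map \<sigma> [0..<Suc i])"
  obtains q where "play_from H t q" "consistent H g q" "sys_wins_play H q"
    "play_length q = play_length p" "\<And>i. enat i < play_length p \<Longrightarrow> state_at q i = \<sigma> i"
proof (cases p)
  case (Infinite \<tau>)
  have \<sigma>: "state_at (Infinite \<sigma>) = \<sigma>" by auto
  show thesis
  proof (rule that[of "Infinite \<sigma>"])
    show "play_from H t (Infinite \<sigma>)" "consistent H g (Infinite \<sigma>)"
      using assms(3,4) steps cons Infinite \<sigma>
      unfolding play_from_def consistent_def by auto
    have "state_at p = \<tau>" using Infinite by auto
    then show "sys_wins_play H (Infinite \<sigma>)"
      using win p(2) Infinite by simp
  qed (use Infinite in auto)
next
  case (EnvDeadlock \<pi>)
  let ?n = "length \<pi>" and ?\<pi> = "map \<sigma> [0..<length \<pi>]"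
  have n: "0 < ?n" using p(1) EnvDeadlock unfolding play_from_def by (simp add: zero_enat_def)
  have last: "last ?\<pi> = \<sigma> (?n - 1)" "last \<pi> = \<pi> ! (?n - 1)"
    using n by (auto simp: last_conv_nth)
  have "\<nexists>x. valid_input G (last \<pi>) x"
    using p(1) EnvDeadlock unfolding play_from_def by simp
  then have dead: "\<nexists>x. valid_input H (last ?\<pi>) x"
    using inp[of "?n - 1"] n EnvDeadlock last by simp
  show thesis
  proof (rule that[of "EnvDeadlock ?\<pi>"])
    show "play_from H t (EnvDeadlock ?\<pi>)"
      using assms(3,4) steps EnvDeadlock n dead
      unfolding play_from_def by (simp add: zero_enat_def)
    have "map (state_at (EnvDeadlock ?\<pi>)) [0..<Suc i] = map \<sigma> [0..<Suc i]" if "Suc i < ?n" for i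
      using that by (intro map_cong) auto
    with cons EnvDeadlock show "consistent H g (EnvDeadlock ?\<pi>)"
      unfolding consistent_def by (simp del: upt_Suc map_eq_conv)
  qed (use EnvDeadlock in auto)
next
  case (SysDeadlock \<pi> x)
  with p(2) show thesis by simp
qed


section \<open>Kleene iteration of monotone operators on a finite lattice of sets\<close>

text \<open>By pigeonhole two iterates coincide; in a chain all iterates between them coincide as
  well.\<close>

lemma eventually_constant_iterates:
  fixes F :: "'a set \<Rightarrow> 'a set"
  assumes "finite A" and bdd: "\<And>S. F S \<subseteq> A"
    and chain: "incseq (\<lambda>i. (F ^^ i) S) \<or> decseq (\<lambda>i. (F ^^ i) S)"
  obtains k where "(F ^^ Suc k) S = (F ^^ k) S"
proof -
  \<comment> \<open>The start \<open>S\<close> is listed apart because it need not lie in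
    \<open>A\<close>: the iteration for \<open>gfp\<close> starts at \<open>UNIV\<close>.\<close>
  have "(F ^^ i) S \<in> insert S (Pow A)" for i
    using bdd by (cases i) auto
  then have "finite (range (\<lambda>i. (F ^^ i) S))"
    using assms(1) by (meson finite_Pow_iff finite_insert finite_subset image_subsetI)
  then have "\<not> inj (\<lambda>i. (F ^^ i) S)"
    using finite_imageD infinite_UNIV_nat by blast
  then obtain i j where "(F ^^ i) S = (F ^^ j) S" "i \<noteq> j"
    unfolding inj_def by blast
  then obtain i j where ij: "(F ^^ i) S = (F ^^ j) S" "i < j"
    by (metis linorder_neqE_nat)
  from chain have "(F ^^ Suc i) S = (F ^^ i) S"
  proof
    assume "incseq (\<lambda>i. (F ^^ i) S)"
    then have "(F ^^ i) S \<subseteq> (F ^^ Suc i) S" "(F ^^ Suc i) S \<subseteq> (F ^^ j) S"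
      using ij(2) unfolding mono_def by (auto simp del: funpow.simps)
    then show ?thesis using ij(1) by blast
  next
    assume "decseq (\<lambda>i. (F ^^ i) S)"
    then have "(F ^^ Suc i) S \<subseteq> (F ^^ i) S" "(F ^^ j) S \<subseteq> (F ^^ Suc i) S"
      using ij(2) unfolding antimono_def by (auto simp del: funpow.simps)
    then show ?thesis using ij(1) by blast
  qed
  then show thesis by (rule that)
qed

text \<open>Brings \<open>lfp\<close> into the shape of the infimum over iterates by which
  \<open>emu_sem\<close> interprets \<open>EMu\<close>, so that the two sides can be compared
  iterate by iterate.\<close>

lemma lfp_eq_UN_iterates:
  fixes F :: "'a set \<Rightarrow> 'a set"
  assumes "mono F" "finite A" "\<And>S. F S \<subseteq> A"
  shows "lfp F = (\<Union>i. (F ^^ i) {})"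
proof -
  have inc: "incseq (\<lambda>i. (F ^^ i) {})"
    using mono_funpow[OF assms(1)] by simp
  obtain k where k: "(F ^^ Suc k) {} = (F ^^ k) {}"
    using eventually_constant_iterates[of A F "{}"] assms inc by metis
  have "lfp F = (F ^^ k) {}"
    using lfp_Kleene_iter[OF assms(1)] k by blast
  moreover have "(F ^^ i) {} \<subseteq> lfp F" for i
    using Kleene_iter_lpfp[OF assms(1), of "lfp F"] lfp_fixpoint[OF assms(1)] by auto
  ultimately show ?thesis by blast
qed

lemma gfp_eq_INT_iterates:
  fixes F :: "'a set \<Rightarrow> 'a set"
  assumes "mono F" "finite A" "\<And>S. F S \<subseteq> A"
  shows "gfp F = (\<Inter>i. (F ^^ i) UNIV)"
proof -
  have dec: "decseq (\<lambda>i. (F ^^ i) UNIV)"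
    using antimono_funpow[OF assms(1)] by simp
  obtain k where k: "(F ^^ Suc k) UNIV = (F ^^ k) UNIV"
    using eventually_constant_iterates[of A F UNIV] assms dec by metis
  have "gfp F = (F ^^ k) UNIV"
    using gfp_Kleene_iter[OF assms(1)] k by simp
  moreover have "gfp F \<subseteq> (F ^^ i) UNIV" for i
    using Kleene_iter_gpfp[OF assms(1), of "gfp F"] gfp_fixpoint[OF assms(1)] by auto
  ultimately show ?thesis by blast
qed

lemma mu_sem_mono:
  assumes "\<And>X. D X \<subseteq> D' X"
  shows "mu_sem G \<phi> D \<subseteq> mu_sem G \<phi> D'"
  using assms
proof (induction \<phi> arbitrary: D D')
  case (Or \<phi> \<psi>)
  then have "mu_sem G \<phi> D \<subseteq> mu_sem G \<phi> D'" "mu_sem G \<psi> D \<subseteq> mu_sem G \<psi> D'" by blast+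
  then show ?case by auto
next
  case (And \<phi> \<psi>)
  then have "mu_sem G \<phi> D \<subseteq> mu_sem G \<phi> D'" "mu_sem G \<psi> D \<subseteq> mu_sem G \<psi> D'" by blast+
  then show ?case by auto
next
  case (Dia \<phi>)
  then have "mu_sem G \<phi> D \<subseteq> mu_sem G \<phi> D'" by blast
  then show ?case unfolding mu_sem.simps by blast
next
  case (Box \<phi>)
  then have "mu_sem G \<phi> D \<subseteq> mu_sem G \<phi> D'" by blast
  then show ?case unfolding mu_sem.simps by blast
next
  case (Mu X \<phi>)
  have "mu_sem G \<phi> (D(X := S)) \<subseteq> mu_sem G \<phi> (D'(X := S))" for S
    by (rule Mu.IH) (use Mu.prems in simp)
  then show ?case by (auto intro!: lfp_mono)
next
  case (Nu X \<phi>)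
  have "mu_sem G \<phi> (D(X := S)) \<subseteq> mu_sem G \<phi> (D'(X := S))" for S
    by (rule Nu.IH) (use Nu.prems in simp)
  then show ?case by (auto intro!: gfp_mono)
qed auto

lemma mono_mu_sem: "mono (\<lambda>S. states G \<inter> mu_sem G \<phi> (D(X := S)))"
proof (rule monoI)
  fix S T :: "'a set set"
  assume "S \<subseteq> T"
  then have "mu_sem G \<phi> (D(X := S)) \<subseteq> mu_sem G \<phi> (D(X := T))"
    by (intro mu_sem_mono) auto
  then show "states G \<inter> mu_sem G \<phi> (D(X := S)) \<subseteq> states G \<inter> mu_sem G \<phi> (D(X := T))"
    by blast
qed


section \<open>Energy values\<close>

definition energies :: "nat \<Rightarrow> enat set" where
  "energies c = {e. e \<le> enat c \<or> e = \<infinity>}"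

lemma eneg_in_energies: "eneg c e \<in> energies c"
  unfolding eneg_def energies_def by (cases e) (auto simp: zero_enat_def)

lemma EC_in_energies: "EC G c s t e \<in> energies c"
  unfolding EC_def energies_def by (auto simp: zero_enat_def)

text \<open>On finite nonzero \<open>e\<close> this is \<open>n < c + 1 - e\<close>, where the
  \<open>+ 1\<close> trades the strict order for the weak one. The extreme values fit because
  \<open>n \<le> c\<close>.\<close>

lemma less_eneg_iff:
  assumes "e \<in> energies c" "n \<le> c"
  shows "enat n < eneg c e \<longleftrightarrow> e + enat n \<le> enat c"
  using assms unfolding eneg_def energies_def by (cases e) (auto simp: zero_enat_def)

lemma eneg_add_le_iff:
  assumes "e \<in> energies c" "n \<le> c"
  shows "eneg c e + enat n \<le> enat c \<longleftrightarrow> enat n < e"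
  using assms unfolding eneg_def energies_def by (cases e) (auto simp: zero_enat_def)

lemma INF_in_range_enat:
  fixes h :: "nat \<Rightarrow> enat"
  shows "(INF i. h i) \<in> range h"
  by (rule wellorder_InfI[of "h 0"]) simp

lemma INF_in_energies:
  assumes "\<And>i :: nat. h i \<in> energies c"
  shows "(INF i. h i) \<in> energies c"
  using INF_in_range_enat[of h] assms by auto

text \<open>A supremum cannot leave \<open>energies c\<close> through the gap above
  \<open>c\<close>: if no member is infinite, all are bounded by \<open>c\<close>.\<close>

lemma SUP_in_energies:
  assumes "\<And>i :: nat. h i \<in> energies c"
  shows "(SUP i. h i) \<in> energies c"
proof (cases "\<exists>i. h i = \<infinity>")
  case True
  then have "(SUP i. h i) = \<infinity>"
    by (metis SUP_upper UNIV_I enat_ord_simps(5))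
  then show ?thesis unfolding energies_def by simp
next
  case False
  then have "h i \<le> enat c" for i
    using assms unfolding energies_def by blast
  then have "(SUP i. h i) \<le> enat c" by (rule SUP_least)
  then show ?thesis unfolding energies_def by simp
qed

lemma add_le_enat_iff: "n \<le> c \<Longrightarrow> e + enat n \<le> enat c \<longleftrightarrow> e \<le> enat (c - n)"
  by (cases e) auto

text \<open>The infimum is attained since \<open>enat\<close> is well-ordered; this provides the
  witness \<open>i\<close>.\<close>

lemma INF_add_le_iff:
  fixes h :: "nat \<Rightarrow> enat"
  assumes "n \<le> c"
  shows "(INF i. h i) + enat n \<le> enat c \<longleftrightarrow> (\<exists>i. h i + enat n \<le> enat c)"
proof -
  show ?thesis
    using INF_in_range_enat[of h] unfolding add_le_enat_iff[OF assms] by (metis INF_lower UNIV_I imageE order_trans)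
qed

lemma SUP_add_le_iff:
  fixes h :: "nat \<Rightarrow> enat"
  assumes "n \<le> c"
  shows "(SUP i. h i) + enat n \<le> enat c \<longleftrightarrow> (\<forall>i. h i + enat n \<le> enat c)"
  unfolding add_le_enat_iff[OF assms] by (simp add: SUP_le_iff)


section \<open>Unfolding the energy level into the game structure\<close>

text \<open>Any subset of \<open>U\<close> of cardinality \<open>e\<close> encodes the energy level \<open>e\<close>, so that
  every state of \<open>H\<close> is meaningful.\<close>

locale energy_unfolding =
  fixes G :: "'v wgs" and c :: nat and U :: "'v set" and H :: "'v gs"
  assumes gs_G: "game_structure G" and gs_H: "game_structure H"
    and finite_U: "finite U" and card_U: "card U = c" and fresh: "U \<inter> vars G = {}"
    and vars_H: "vars H = vars G \<union> U" and inputs_H: "inputs H = inputs G"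
    and rho_e_H: "rho_e H = rho_e G" and win_cond_H: "win_cond H = win_cond G"
    and rho_s_H: "\<And>s t. psat (with_primed s t) (rho_s H) \<longleftrightarrow>
      psat (with_primed (s \<inter> vars G) (t \<inter> vars G)) (rho_s G) \<and>
      0 \<le> int (card (s \<inter> U)) + weight G (s \<inter> vars G) (t \<inter> vars G) \<and>
      int (card (t \<inter> U)) =
        min (int c) (int (card (s \<inter> U)) + weight G (s \<inter> vars G) (t \<inter> vars G))"

lemma energy_unfolding_exists:
  fixes G :: "'v::infinite wgs"
  assumes "game_structure G"
  obtains U H where "energy_unfolding G c U H"
proof -
  let ?V = "vars G"
  have fin: "finite ?V" using assms unfolding game_structure_def by simp
  then have "infinite (- ?V)"
    by (metis Compl_UNIV_eq Diff_infinite_finite infinite_UNIV Compl_eq_Diff_UNIV)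
  then obtain U where U: "U \<subseteq> - ?V" "finite U" "card U = c"
    using infinite_arbitrarily_large by blast
  define P where "P = (\<lambda>s t. psat (with_primed (s \<inter> ?V) (t \<inter> ?V)) (rho_s G) \<and>
      0 \<le> int (card (s \<inter> U)) + weight G (s \<inter> ?V) (t \<inter> ?V) \<and>
      int (card (t \<inter> U)) = min (int c) (int (card (s \<inter> U)) + weight G (s \<inter> ?V) (t \<inter> ?V)))"
  let ?A = "Cur ` (?V \<union> U) \<union> Nxt ` (?V \<union> U)"
  have "finite ?A" using fin U(2) by simp
  \<comment> \<open>\<open>Cur -\<close> and \<open>Nxt -\<close> recover the two states from one
    assignment over unprimed and primed variables.\<close>
  then obtain f where f: "pvars f \<subseteq> ?A"
    "\<And>B. psat B f \<longleftrightarrow> P (Cur -` (B \<inter> ?A)) (Nxt -` (B \<inter> ?A))"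
    using functional_completeness[of ?A "\<lambda>B. P (Cur -` B) (Nxt -` B)"] by blast
  have "Cur -` (with_primed s t \<inter> ?A) = s \<inter> (?V \<union> U)"
    "Nxt -` (with_primed s t \<inter> ?A) = t \<inter> (?V \<union> U)" for s t
    unfolding with_primed_def by auto
  moreover have "s \<inter> (?V \<union> U) \<inter> ?V = s \<inter> ?V" "s \<inter> (?V \<union> U) \<inter> U = s \<inter> U" for s
    by auto
  ultimately have sat: "psat (with_primed s t) f \<longleftrightarrow> P s t" for s t
    unfolding f(2) P_def by simp
  define H :: "'v gs" where "H = \<lparr>vars = ?V \<union> U, inputs = inputs G, rho_e = rho_e G,
    rho_s = f, win_cond = win_cond G\<rparr>"
  have "game_structure H"
    using assms f(1) U(2) omega_regular_over_mono[of ?V "win_cond G" "?V \<union> U"]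
    unfolding game_structure_def H_def by auto
  then have "energy_unfolding G c U H"
    using assms U sat unfolding energy_unfolding_def P_def H_def by auto
  then show thesis by (rule that)
qed

context energy_unfolding
begin

lemma inputs_subset: "inputs G \<subseteq> vars G" "inputs H \<subseteq> vars H"
  using gs_G gs_H unfolding game_structure_def by auto

lemma states_H_iff: "t \<in> states H \<longleftrightarrow> t \<subseteq> vars G \<union> U"
  unfolding states_def vars_H by simp

lemma card_le: "card (t \<inter> U) \<le> c"
  using finite_U card_U by (metis card_mono inf_le2)

text \<open>\<open>rho_e G\<close> mentions no variable of \<open>U\<close>, so the stored energy
  never influences the choices of the environment.\<close>

lemma valid_input_H: "valid_input H s x \<longleftrightarrow> valid_input G (s \<inter> vars G) x"
proof -
  have "pvars (rho_e G) \<subseteq> Cur ` vars G \<union> Nxt ` inputs G"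
    using gs_G unfolding game_structure_def by simp
  then have "psat (with_primed s x) (rho_e G) \<longleftrightarrow> psat (with_primed (s \<inter> vars G) x) (rho_e G)"
    by (intro psat_cong) (auto simp: with_primed_def)
  then show ?thesis
    unfolding valid_input_def inputs_H rho_e_H by simp
qed

lemma step_H:
  "step H s t \<longleftrightarrow> t \<subseteq> vars G \<union> U \<and> step G (s \<inter> vars G) (t \<inter> vars G) \<and>
    0 \<le> int (card (s \<inter> U)) + weight G (s \<inter> vars G) (t \<inter> vars G) \<and>
    int (card (t \<inter> U)) =
      min (int c) (int (card (s \<inter> U)) + weight G (s \<inter> vars G) (t \<inter> vars G))"
proof -
  have "t \<inter> vars G \<inter> inputs G = t \<inter> inputs G" using inputs_subset by blast
  then show ?thesis
    unfolding step_iff[OF inputs_subset(1)] step_iff[OF inputs_subset(2)]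
      rho_s_H valid_input_H inputs_H vars_H by auto
qed

text \<open>Fixing one code per level makes the lifting of a play of \<open>G\<close> to
  \<open>H\<close> a function. For \<open>e > c\<close> there is no such subset of \<open>U\<close>
  and the value is arbitrary.\<close>

definition enc :: "nat \<Rightarrow> 'v set" where
  "enc e = (SOME A. A \<subseteq> U \<and> card A = e)"

lemma enc: "e \<le> c \<Longrightarrow> enc e \<subseteq> U \<and> card (enc e) = e"
  unfolding enc_def by (rule someI_ex) (metis card_U obtain_subset_with_card_n)

lemma encoded_state:
  assumes "s \<subseteq> vars G" "e \<le> c"
  shows "(s \<union> enc e) \<inter> vars G = s" "card ((s \<union> enc e) \<inter> U) = e" "s \<union> enc e \<subseteq> vars G \<union> U"
proof -
  have e: "enc e \<subseteq> U" "card (enc e) = e" using enc[OF assms(2)] by auto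
  then show "(s \<union> enc e) \<inter> vars G = s" "s \<union> enc e \<subseteq> vars G \<union> U"
    using assms(1) fresh by auto
  have "(s \<union> enc e) \<inter> U = enc e" using e assms(1) fresh by auto
  then show "card ((s \<union> enc e) \<inter> U) = e" using e by simp
qed

subsection \<open>Strategies\<close>

text \<open>The strategy \<open>h\<close> in \<open>H\<close> forgets \<open>U\<close> and asks
  \<open>g\<close>. A play that the system wins against \<open>h\<close> would project to a play
  against \<open>g\<close> whose energy levels are cardinalities, hence non-negative, contradicting
  that \<open>g\<close> wins.\<close>

lemma env_wins_H_if_env_wins_energy:
  assumes "env_wins_energy G (t \<inter> vars G) (enat c) (card (t \<inter> U))" "t \<in> states H"
  shows "t \<in> env_winning_region H"
proof -
  let ?r = "\<lambda>s. s \<inter> vars G"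
  obtain g where g: "env_strategy_from G (?r t) g"
    and gwin: "\<And>p. play_from G (?r t) p \<Longrightarrow> consistent G g p \<Longrightarrow>
      \<not> wins_energy G (enat c) (card (t \<inter> U)) p"
    using assms(1) unfolding env_wins_energy_def by blast
  define h where "h = (\<lambda>\<pi>. g (map ?r \<pi>))"
  have int_inputs: "?r s \<inter> inputs G = s \<inter> inputs G" for s
    using inputs_subset by blast
  have "valid_input H (last \<pi>) (h \<pi>)"
    if \<pi>: "consistent_prefix H h t \<pi>" and x: "valid_input H (last \<pi>) x" for \<pi> x
  proof -
    have ne: "\<pi> \<noteq> []" using \<pi> unfolding consistent_prefix_def by simp
    have "consistent_prefix G g (?r t) (map ?r \<pi>)"
      using \<pi> ne unfolding consistent_prefix_def h_def step_H inputs_H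
      by (auto simp: hd_map take_map int_inputs)
    moreover have "last (map ?r \<pi>) = ?r (last \<pi>)" using ne by (simp add: last_map)
    ultimately show ?thesis
      using g x unfolding env_strategy_from_def h_def valid_input_H by metis
  qed
  then have h: "env_strategy_from H t h"
    unfolding env_strategy_from_def by blast
  have "\<not> sys_wins_play H p" if p: "play_from H t p" "consistent H h p" for p
  proof
    assume win: "sys_wins_play H p"
    let ?\<sigma> = "\<lambda>i. ?r (state_at p i)"
    have steps: "step H (state_at p i) (state_at p (Suc i))" if "enat (Suc i) < play_length p" for i
      using p(1) that unfolding play_from_def by blast
    have p0: "state_at p 0 = t" using p(1) unfolding play_from_def by simp
    have energy: "int (card (state_at p i \<inter> U)) =
        energy_level G (enat c) (card (t \<inter> U)) ?\<sigma> i" if "enat i < play_length p" for i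
      using that
    proof (induction i)
      case 0
      then show ?case using p0 by simp
    next
      case (Suc i)
      then have "enat i < play_length p"
        by (metis Suc_ile_eq order_less_imp_le)
      then show ?case using Suc.IH steps[OF Suc.prems] unfolding step_H by simp
    qed
    obtain q where q: "play_from G (?r t) q" "consistent G g q" "sys_wins_play G q"
      "play_length q = play_length p" "\<And>i. enat i < play_length p \<Longrightarrow> state_at q i = ?\<sigma> i"
    proof (rule sys_wins_play_transfer[of H t p "?r t" G ?\<sigma> g])
      show "?r t \<in> states G" unfolding states_def by simp
      show "step G (?\<sigma> i) (?\<sigma> (Suc i))" if "enat (Suc i) < play_length p" for i
        using steps[OF that] unfolding step_H by blast
      show "?\<sigma> \<in> win_cond G" if "state_at p \<in> win_cond H"
        using that gs_G omega_regular_over_restrict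
        unfolding win_cond_H game_structure_def by blast
      show "?\<sigma> (Suc i) \<inter> inputs G = g (map ?\<sigma> [0..<Suc i])" if "enat (Suc i) < play_length p" for i
        using p(2) that unfolding consistent_def h_def inputs_H int_inputs
        by (auto simp: comp_def)
    qed (use p win p0 in \<open>auto simp: valid_input_H\<close>)
    have "0 \<le> energy_level G (enat c) (card (t \<inter> U)) (state_at q) k"
      if "enat k < play_length q" for k
    \<comment> \<open>\<open>q\<close> agrees with the projected sequence only below the length of
      the play, so the levels are compared position by position.\<close>
    proof -
      have "enat j < play_length p" if "j \<le> k" for j
        using that \<open>enat k < play_length q\<close> q(4) by (metis enat_ord_simps(1) order_le_less_trans)
      then have "energy_level G (enat c) (card (t \<inter> U)) (state_at q) k =
          energy_level G (enat c) (card (t \<inter> U)) ?\<sigma> k"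
        by (intro energy_level_cong q(5))
      then show ?thesis using energy[of k] that q(4) by simp
    qed
    then show False using gwin[OF q(1,2)] q(3) unfolding wins_energy_def by blast
  qed
  with h assms(2) show ?thesis unfolding env_winning_region_def by blast
qed

text \<open>The strategy \<open>g\<close> recomputes the energy levels from the history, adds their
  codes to the states and asks \<open>h\<close>. A play against \<open>g\<close> that the system
  wins with non-negative energy would lift to one won against \<open>h\<close>.\<close>

lemma env_wins_energy_if_env_wins_H:
  assumes "s \<union> enc c\<^sub>0 \<in> env_winning_region H" "s \<in> states G" "c\<^sub>0 \<le> c"
  shows "env_wins_energy G s (enat c) c\<^sub>0"
proof -
  let ?r = "\<lambda>s. s \<inter> vars G"
  obtain h where h: "env_strategy_from H (s \<union> enc c\<^sub>0) h"
    and hwin: "\<And>p. play_from H (s \<union> enc c\<^sub>0) p \<Longrightarrow> consistent H h p \<Longrightarrow> \<not> sys_wins_play H p"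
    using assms(1) unfolding env_winning_region_def by blast
  \<comment> \<open>\<open>nat\<close> sends negative levels to 0; this is harmless, as a play
    reaching such a level does not win the energy objective.\<close>
  define lift where "lift = (\<lambda>\<sigma> i. \<sigma> i \<union> enc (nat (energy_level G (enat c) c\<^sub>0 \<sigma> i)))"
  define lift_list where "lift_list = (\<lambda>\<pi>. map (lift (nth \<pi>)) [0..<length \<pi>])"
  \<comment> \<open>After a negative level the lifted history need not be a prefix of a play of
    \<open>H\<close>, and the answer of \<open>h\<close> may be invalid in \<open>G\<close>. The
    default keeps \<open>g\<close> a strategy; \<open>follows\<close> shows that it determines no
    move of a play that the system wins.\<close>
  define g where "g = (\<lambda>\<pi>. if valid_input G (last \<pi>) (h (lift_list \<pi>)) then h (lift_list \<pi>)
    else SOME x. valid_input G (last \<pi>) x)"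
  have "env_strategy_from G s g"
    unfolding env_strategy_from_def g_def by (auto intro: someI)
  moreover have "\<not> wins_energy G (enat c) c\<^sub>0 p" if p: "play_from G s p" "consistent G g p" for p
  proof
    assume win: "wins_energy G (enat c) c\<^sub>0 p"
    let ?\<sigma> = "state_at p"
    let ?\<tau> = "lift ?\<sigma>" and ?e = "energy_level G (enat c) c\<^sub>0 ?\<sigma>"
    have steps: "step G (?\<sigma> i) (?\<sigma> (Suc i))" if "enat (Suc i) < play_length p" for i
      using p(1) that unfolding play_from_def by blast
    have \<sigma>0: "?\<sigma> 0 = s" using p(1) unfolding play_from_def by simp
    have Suc_lt: "enat i < play_length p" if "enat (Suc i) < play_length p" for i
      using that by (metis Suc_ile_eq order_less_imp_le)
    have sub: "?\<sigma> i \<subseteq> vars G" if "enat i < play_length p" for i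
    proof (cases i)
      case 0
      then show ?thesis using \<sigma>0 assms(2) unfolding states_def by simp
    next
      case (Suc j)
      then show ?thesis
        using steps[of j] that unfolding step_iff[OF inputs_subset(1)] by simp
    qed
    have nonneg: "0 \<le> ?e i" if "enat i < play_length p" for i
      using win that unfolding wins_energy_def by blast
    have e_le: "nat (?e i) \<le> c" for i
      using energy_level_le[OF assms(3)] by (metis nat_le_iff)
    have \<tau>: "?r (?\<tau> i) = ?\<sigma> i" "int (card (?\<tau> i \<inter> U)) = ?e i" "?\<tau> i \<subseteq> vars G \<union> U"
      if "enat i < play_length p" for i
      using encoded_state[OF sub[OF that] e_le[of i]] nonneg[OF that] unfolding lift_def by auto
    have \<tau>0: "?\<tau> 0 = s \<union> enc c\<^sub>0" unfolding lift_def using \<sigma>0 by simp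
    have steps_H: "step H (?\<tau> i) (?\<tau> (Suc i))" if "enat (Suc i) < play_length p" for i
    proof -
      \<comment> \<open>The new level is the sum capped at \<open>c \<ge> 0\<close>; its
        non-negativity gives that of the uncapped sum, which \<open>rho_s H\<close> demands.\<close>
      have "?e (Suc i) = min (int c) (?e i + weight G (?\<sigma> i) (?\<sigma> (Suc i)))" by simp
      moreover have "0 \<le> ?e (Suc i)" using nonneg[OF that] .
      ultimately show ?thesis
        using steps[OF that] \<tau>[OF that] \<tau>[OF Suc_lt[OF that]] unfolding step_H by simp
    qed
    \<comment> \<open>Level \<open>i\<close> depends only on the states up to \<open>i\<close>, so
      lifting commutes with taking prefixes.\<close>
    have lift_prefix: "lift_list (map ?\<sigma> [0..<n]) = map ?\<tau> [0..<n]" for n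
    proof -
      have "energy_level G (enat c) c\<^sub>0 (nth (map ?\<sigma> [0..<n])) i = ?e i" if "i < n" for i
        using that by (intro energy_level_cong) auto
      then show ?thesis unfolding lift_list_def lift_def by auto
    qed
    \<comment> \<open>Agreement with \<open>h\<close> at one move needs consistency of the lifted
      prefix before it, and \<open>prefix\<close> needs the agreement at earlier moves. Hence
      consistency is an assumption here, discharged by the induction in
      \<open>prefix\<close>.\<close>
    have follows: "?\<tau> (Suc i) \<inter> inputs H = h (map ?\<tau> [0..<Suc i])"
      if i: "enat (Suc i) < play_length p"
        and pre: "consistent_prefix H h (s \<union> enc c\<^sub>0) (map ?\<tau> [0..<Suc i])" for i
    proof -
      have last: "last (map f [0..<Suc i]) = f i" for f :: "nat \<Rightarrow> 'v set" by simp
      have "\<exists>x. valid_input H (?\<tau> i) x"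
        using steps_H[OF i] unfolding step_def by blast
      then have "valid_input H (?\<tau> i) (h (map ?\<tau> [0..<Suc i]))"
        using h pre last unfolding env_strategy_from_def by metis
      then have "valid_input G (?\<sigma> i) (h (map ?\<tau> [0..<Suc i]))"
        unfolding valid_input_H using \<tau>(1)[OF Suc_lt[OF i]] by simp
      then have "g (map ?\<sigma> [0..<Suc i]) = h (map ?\<tau> [0..<Suc i])"
        unfolding g_def lift_prefix last by simp
      moreover have "?\<sigma> (Suc i) \<inter> inputs G = g (map ?\<sigma> [0..<Suc i])"
        using p(2) i unfolding consistent_def by blast
      moreover have "?\<tau> (Suc i) \<inter> inputs H = ?\<sigma> (Suc i) \<inter> inputs G"
        using \<tau>(1)[OF i] inputs_subset(1) unfolding inputs_H by blast
      ultimately show ?thesis by simp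
    qed
    have prefix: "consistent_prefix H h (s \<union> enc c\<^sub>0) (map ?\<tau> [0..<Suc i])"
      if "enat i < play_length p" for i
      using that
    proof (induction i)
      case 0
      then show ?case using \<tau>0 unfolding consistent_prefix_def by simp
    next
      case (Suc i)
      note pre = Suc.IH[OF Suc_lt[OF Suc.prems]]
      have "consistent_prefix H h (s \<union> enc c\<^sub>0) (map ?\<tau> [0..<Suc i] @ [?\<tau> (Suc i)])"
        using follows[OF Suc.prems pre] steps_H[OF Suc.prems]
        by (intro consistent_prefix_snoc[OF pre]) auto
      then show ?case by simp
    qed
    obtain q where "play_from H (s \<union> enc c\<^sub>0) q" "consistent H h q" "sys_wins_play H q"
    proof (rule sys_wins_play_transfer[of G s p "s \<union> enc c\<^sub>0" H ?\<tau> h])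
      show "sys_wins_play G p" using win unfolding wins_energy_def by blast
      show "s \<union> enc c\<^sub>0 \<in> states H"
        using assms(1) unfolding env_winning_region_def by blast
      show "(\<exists>x. valid_input H (?\<tau> i) x) \<longleftrightarrow> (\<exists>x. valid_input G (?\<sigma> i) x)"
        if "enat i < play_length p" for i
        using \<tau>(1)[OF that] unfolding valid_input_H by simp
      show "?\<tau> \<in> win_cond H" if "play_length p = \<infinity>" "?\<sigma> \<in> win_cond G"
      proof -
        have "(\<lambda>i. ?r (?\<tau> i)) = ?\<sigma>" using \<tau>(1) that(1) by auto
        then show ?thesis
          using that(2) gs_G omega_regular_over_restrict[of "vars G" "win_cond G" ?\<tau>]
          unfolding win_cond_H game_structure_def by simp
      qed
      show "?\<tau> (Suc i) \<inter> inputs H = h (map ?\<tau> [0..<Suc i])" if "enat (Suc i) < play_length p" for i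
        using follows[OF that prefix[OF Suc_lt[OF that]]] .
    qed (use p \<tau>0 steps_H in auto)
    then show False using hwin by blast
  qed
  ultimately show ?thesis unfolding env_wins_energy_def by blast
qed

subsection \<open>Formulas\<close>

text \<open>\<open>c - f\<close> is the largest energy level at which a state still belongs to
  \<open>S\<close>. Values are kept in \<open>energies c\<close> for the laws of
  \<open>eneg\<close>; only states matter, since \<open>f\<close> and \<open>S\<close> are
  uncontrolled elsewhere.\<close>

definition represents :: "('v set \<Rightarrow> enat) \<Rightarrow> 'v set set \<Rightarrow> bool" where
  "represents f S \<longleftrightarrow> (\<forall>s \<in> states G. f s \<in> energies c) \<and>
    (\<forall>t \<in> states H. t \<in> S \<longleftrightarrow> f (t \<inter> vars G) + enat (card (t \<inter> U)) \<le> enat c)"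

text \<open>\<open>n < EC\<close> says that credit \<open>n\<close> is too small for this move: the
  output is invalid, the energy turns negative, or the new level misses the demand \<open>e\<close>.
  Capping at \<open>c\<close> does not affect the last test, because a finite \<open>e\<close> is at
  most \<open>c\<close>.\<close>

lemma less_EC_iff:
  assumes "n \<le> c" "x \<subseteq> inputs G" "y \<subseteq> outputs G" "e \<in> energies c"
  shows "enat n < EC G c s (x \<union> y) e \<longleftrightarrow> valid_input G s x \<and>
    (valid_output G s x y \<and> 0 \<le> int n + weight G s (x \<union> y) \<longrightarrow>
      enat (nat (min (int c) (int n + weight G s (x \<union> y)))) < e)"
proof -
  have x: "(x \<union> y) \<inter> inputs G = x"
    using assms(2,3) unfolding outputs_def by blast
  show ?thesis
    using assms unfolding EC_def x valid_input_def valid_output_def energies_def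
    by (cases e) (auto simp: zero_enat_def)
qed

text \<open>The outer negation turns the claim into \<open>n < ECpre_sys\<close>: some input leaves
  every output short of credit. By \<open>less_EC_iff\<close> each output then loses energy, and is
  deleted in \<open>H\<close>, or lands at a level below the inner negation, which
  \<open>less_eneg_iff\<close> reads as membership in \<open>?S\<close>.\<close>

lemma represents_Box:
  assumes "represents (emu_sem G c (to_energy \<phi>) D) (mu_sem H \<phi> E)"
  shows "represents (emu_sem G c (to_energy (Box \<phi>)) D) (mu_sem H (Box \<phi>) E)"
proof -
  let ?f = "emu_sem G c (to_energy \<phi>) D" and ?S = "mu_sem H \<phi> E" and ?V = "vars G"
  let ?EC = "\<lambda>s x y. EC G c s (x \<union> y) (eneg c (?f (x \<union> y)))"
  let ?pre = "ECpre_sys G c (\<lambda>t. eneg c (?f t))"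
  have finV: "finite ?V" using gs_G unfolding game_structure_def by simp
  have fin: "finite (Pow (inputs G))" "finite (Pow (outputs G))"
    using finV inputs_subset(1) unfolding outputs_def by (auto intro: finite_subset)
  have ne: "Pow (inputs G) \<noteq> {}" "Pow (outputs G) \<noteq> {}" by auto
  have f: "?f t \<in> energies c" if "t \<in> states G" for t
    using assms that unfolding represents_def by blast
  have S: "t \<in> ?S \<longleftrightarrow> ?f (t \<inter> ?V) + enat (card (t \<inter> U)) \<le> enat c" if "t \<in> states H" for t
    using assms that unfolding represents_def by blast
  have pre_in: "?pre s \<in> energies c" for s
  proof -
    have "(MIN y\<in>Pow (outputs G). ?EC s x y) \<in> energies c" for x
      using Min_in[of "?EC s x ` Pow (outputs G)"] fin(2) EC_in_energies by fastforce
    moreover have "?pre s \<in> (\<lambda>x. MIN y\<in>Pow (outputs G). ?EC s x y) ` Pow (inputs G)"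
      unfolding ECpre_sys_def using fin(1) by (intro Max_in) auto
    ultimately show ?thesis by auto
  qed
  have "t \<in> mu_sem H (Box \<phi>) E \<longleftrightarrow> eneg c (?pre (t \<inter> ?V)) + enat (card (t \<inter> U)) \<le> enat c"
    if t: "t \<in> states H" for t
  proof -
    let ?s = "t \<inter> ?V" and ?n = "card (t \<inter> U)"
    let ?w = "\<lambda>u. int ?n + weight G ?s u"
    \<comment> \<open>Outputs in \<open>H\<close> are outputs of \<open>G\<close> that keep the
      energy non-negative, together with any code of the new level.\<close>
    have inner: "(\<forall>y. valid_output H t x y \<longrightarrow> x \<union> y \<in> ?S) \<longleftrightarrow>
        (\<forall>y \<subseteq> outputs G. valid_output G ?s x y \<and> 0 \<le> ?w (x \<union> y) \<longrightarrow>
          enat (nat (min (int c) (?w (x \<union> y)))) < eneg c (?f (x \<union> y)))" (is "?L \<longleftrightarrow> ?R")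
      if x: "x \<subseteq> inputs G" for x
    proof
      assume L: ?L
      show ?R
      proof (intro allI impI)
        fix y
        assume y: "y \<subseteq> outputs G" "valid_output G ?s x y \<and> 0 \<le> ?w (x \<union> y)"
        let ?m = "nat (min (int c) (?w (x \<union> y)))"
        have xy: "x \<union> y \<subseteq> ?V" using x y(1) inputs_subset(1) unfolding outputs_def by blast
        have m: "?m \<le> c" by simp
        note enc_m = encoded_state[OF xy m]
        \<comment> \<open>To use \<open>?L\<close>, \<open>y\<close> is completed by one code of its
          new level \<open>?m\<close>.\<close>
        have "y \<union> enc ?m \<subseteq> outputs H"
          using y(1) enc[OF m] fresh inputs_subset(1) unfolding outputs_def vars_H inputs_H by blast
        then have "valid_output H t x (y \<union> enc ?m)"
          using y(2) enc_m unfolding valid_output_def rho_s_H by (simp add: Un_assoc)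
        then have "x \<union> y \<union> enc ?m \<in> ?S" using L by (simp add: Un_assoc)
        moreover have "x \<union> y \<union> enc ?m \<in> states H" using enc_m(3) states_H_iff by blast
        ultimately show "enat ?m < eneg c (?f (x \<union> y))"
          using S enc_m f[of "x \<union> y"] xy less_eneg_iff[OF _ m] unfolding states_def by simp
      qed
    next
      assume R: ?R
      show ?L
      proof (intro allI impI)
        fix z
        assume z: "valid_output H t x z"
        \<comment> \<open>Conversely, \<open>z\<close> is stripped of its code;
          \<open>rho_s H\<close> fixes the cardinality of that code to \<open>?m\<close>.\<close>
        let ?y = "z - U" and ?u = "x \<union> z"
        let ?m = "nat (min (int c) (?w (x \<union> ?y)))"
        have zsub: "z \<subseteq> outputs G \<union> U"
          using z unfolding valid_output_def outputs_def vars_H inputs_H by blast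
        have y: "?y \<subseteq> outputs G" using zsub by blast
        have r: "?u \<inter> ?V = x \<union> ?y"
          using x zsub fresh inputs_subset(1) unfolding outputs_def by blast
        have "valid_output G ?s x ?y" "0 \<le> ?w (x \<union> ?y)" and m: "card (?u \<inter> U) = ?m"
          using z y unfolding valid_output_def rho_s_H r by auto
        then have "enat (card (?u \<inter> U)) < eneg c (?f (?u \<inter> ?V))"
          using R y unfolding r by simp
        then have "?f (?u \<inter> ?V) + enat (card (?u \<inter> U)) \<le> enat c"
          using less_eneg_iff[OF f card_le] unfolding states_def by blast
        moreover have "?u \<in> states H"
          using x zsub inputs_subset(1) unfolding states_H_iff outputs_def by blast
        ultimately show "?u \<in> ?S" using S by blast
      qed
    qed
    \<comment> \<open>Used to pull \<open>valid_input\<close> out of the quantifier over outputs;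
      the range contains \<open>{}\<close>, so it is not empty.\<close>
    have conj_all: "(\<forall>y \<subseteq> Y. A \<and> Q y) \<longleftrightarrow> A \<and> (\<forall>y \<subseteq> Y. Q y)" for Y :: "'v set" and A Q
      by blast
    have "eneg c (?pre ?s) + enat ?n \<le> enat c \<longleftrightarrow> enat ?n < ?pre ?s"
      by (rule eneg_add_le_iff[OF pre_in card_le])
    also have "\<dots> \<longleftrightarrow> (\<exists>x \<subseteq> inputs G. \<forall>y \<subseteq> outputs G. enat ?n < ?EC ?s x y)"
      unfolding ECpre_sys_def using fin ne
      by (simp add: Max_gr_iff Min_gr_iff) (simp add: Bex_def Ball_def)
    also have "\<dots> \<longleftrightarrow> (\<exists>x \<subseteq> inputs G. \<forall>y \<subseteq> outputs G. valid_input G ?s x \<and>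
        (valid_output G ?s x y \<and> 0 \<le> ?w (x \<union> y) \<longrightarrow>
          enat (nat (min (int c) (?w (x \<union> y)))) < eneg c (?f (x \<union> y))))"
      using less_EC_iff[OF card_le _ _ eneg_in_energies] by (simp cong: conj_cong imp_cong)
    also have "\<dots> \<longleftrightarrow> (\<exists>x \<subseteq> inputs G. valid_input G ?s x \<and>
        (\<forall>y. valid_output H t x y \<longrightarrow> x \<union> y \<in> ?S))"
      unfolding conj_all by (rule ex_cong1, rule conj_cong[OF refl]) (simp only: inner)
    also have "\<dots> \<longleftrightarrow> t \<in> mu_sem H (Box \<phi>) E"
      unfolding mu_sem.simps valid_input_H using t by (auto simp: valid_input_def)
    finally show ?thesis by blast
  qed
  then show ?thesis
    using eneg_in_energies unfolding represents_def by simp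
qed

lemma represents_iterates:
  assumes "represents f S" "\<And>h T. represents h T \<Longrightarrow> represents (\<Phi> h) (\<Psi> T)"
  shows "represents ((\<Phi> ^^ i) f) ((\<Psi> ^^ i) S)"
  using assms by (induction i) auto

lemma represents_INF:
  assumes "\<And>i :: nat. represents (h i) (S i)"
  shows "represents (\<lambda>s. INF i. h i s) (\<Union>i. S i)"
  using assms INF_add_le_iff[OF card_le] unfolding represents_def
  by (auto intro!: INF_in_energies)

lemma represents_SUP:
  assumes "\<And>i :: nat. represents (h i) (S i)"
  shows "represents (\<lambda>s. SUP i. h i s) (\<Inter>i. S i)"
  using assms SUP_add_le_iff[OF card_le] unfolding represents_def
  by (auto intro!: SUP_in_energies)

text \<open>Absorbs the intersection with \<open>states H\<close> inside the fixed-point operators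
  of \<open>mu_sem\<close>.\<close>

lemma represents_states: "represents f (states H \<inter> S) \<longleftrightarrow> represents f S"
  unfolding represents_def by auto

text \<open>Literals over \<open>vars G\<close> do not see \<open>U\<close>; minimum and maximum of
  thresholds give union and intersection. For fixed points the iterates represent each other,
  starting from \<open>\<infinity>\<close> with \<open>{}\<close> and from 0 with
  \<open>UNIV\<close>.\<close>

lemma represents_mu_sem:
  assumes "in_L_env \<phi>" "mu_lits \<phi> \<subseteq> vars G"
    and "\<And>X. X \<in> mu_free \<phi> \<Longrightarrow> represents (D X) (E X)"
  shows "represents (emu_sem G c (to_energy \<phi>) D) (mu_sem H \<phi> E)"
  using assms
proof (induction \<phi> arbitrary: D E)
  case (Lit v)
  then show ?case
    using card_le unfolding represents_def energies_def by (auto simp: zero_enat_def)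
next
  case (NLit v)
  then show ?case
    using card_le unfolding represents_def energies_def by (auto simp: zero_enat_def)
next
  case (RVar X)
  then show ?case by simp
next
  case (Or \<phi> \<psi>)
  then have "represents (emu_sem G c (to_energy \<phi>) D) (mu_sem H \<phi> E)"
    "represents (emu_sem G c (to_energy \<psi>) D) (mu_sem H \<psi> E)"
    by simp_all
  then show ?case
    unfolding represents_def add_le_enat_iff[OF card_le] by (auto simp: min_def)
next
  case (And \<phi> \<psi>)
  then have "represents (emu_sem G c (to_energy \<phi>) D) (mu_sem H \<phi> E)"
    "represents (emu_sem G c (to_energy \<psi>) D) (mu_sem H \<psi> E)"
    by simp_all
  then show ?case
    unfolding represents_def add_le_enat_iff[OF card_le] by (auto simp: max_def)
next
  case (Dia \<phi>)
  then show ?case by simp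
next
  case (Box \<phi>)
  then show ?case by (intro represents_Box) simp
next
  case (Mu X \<phi>)
  let ?\<Phi> = "\<lambda>h. emu_sem G c (to_energy \<phi>) (D(X := h))"
  let ?\<Psi> = "\<lambda>S. states H \<inter> mu_sem H \<phi> (E(X := S))"
  have step: "represents (?\<Phi> h) (?\<Psi> T)" if "represents h T" for h T
    unfolding represents_states using Mu.prems that by (intro Mu.IH) auto
  have base: "represents (\<lambda>_. \<infinity>) {}"
    unfolding represents_def energies_def by simp
  have "represents ((?\<Phi> ^^ i) (\<lambda>_. \<infinity>)) ((?\<Psi> ^^ i) {})" for i
    by (rule represents_iterates[OF base step])
  moreover have "lfp ?\<Psi> = (\<Union>i. (?\<Psi> ^^ i) {})"
    by (rule lfp_eq_UN_iterates[of _ "states H", OF mono_mu_sem])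
      (use gs_H in \<open>auto simp: game_structure_def states_def\<close>)
  ultimately show ?case using represents_INF by simp
next
  case (Nu X \<phi>)
  let ?\<Phi> = "\<lambda>h. emu_sem G c (to_energy \<phi>) (D(X := h))"
  let ?\<Psi> = "\<lambda>S. states H \<inter> mu_sem H \<phi> (E(X := S))"
  have step: "represents (?\<Phi> h) (?\<Psi> T)" if "represents h T" for h T
    unfolding represents_states using Nu.prems that by (intro Nu.IH) auto
  have base: "represents (\<lambda>_. 0) UNIV"
    using card_le unfolding represents_def energies_def by (simp add: zero_enat_def)
  have "represents ((?\<Phi> ^^ i) (\<lambda>_. 0)) ((?\<Psi> ^^ i) UNIV)" for i
    by (rule represents_iterates[OF base step])
  moreover have "gfp ?\<Psi> = (\<Inter>i. (?\<Psi> ^^ i) UNIV)"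
    by (rule gfp_eq_INT_iterates[of _ "states H", OF mono_mu_sem])
      (use gs_H in \<open>auto simp: game_structure_def states_def\<close>)
  ultimately show ?case using represents_SUP by simp
qed

end

section \<open>From the unfolded game back to initial credits\<close>

theorem theorem3p7:
  fixes \<phi> :: "(nat \<Rightarrow> 'v::infinite set) set"
    and \<psi> :: "('v, 'r) mu"
    and G :: "'v wgs"
    and c :: nat
    and D :: "'r \<Rightarrow> 'v set \<Rightarrow> enat"
    and s :: "'v set"
  assumes "omega_regular \<phi>"
    and "mu_closed \<psi>"
    and "in_L_env \<psi>"
    and "env_matches \<psi> \<phi>"
    and "game_structure G"
    and "win_cond G = \<phi>"
    and "mu_lits \<psi> \<subseteq> vars G"
    and "s \<in> states G"
  shows "(emu_sem G c (to_energy \<psi>) D s \<noteq> \<infinity> \<longrightarrow>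
            (\<exists>m :: nat. emu_sem G c (to_energy \<psi>) D s + enat m = enat c \<and>
               env_wins_energy G s (enat c) m \<and>
               (\<forall>c\<^sub>0 \<le> c. env_wins_energy G s (enat c) c\<^sub>0 \<longrightarrow> c\<^sub>0 \<le> m))) \<and>
         (emu_sem G c (to_energy \<psi>) D s = \<infinity> \<longrightarrow>
            (\<forall>c\<^sub>0 \<le> c. \<not> env_wins_energy G s (enat c) c\<^sub>0))"
proof -
  obtain U and H :: "'v gs" where "energy_unfolding G c U H"
    using energy_unfolding_exists[OF assms(5)] by blast
  then interpret energy_unfolding G c U H .
  let ?f = "emu_sem G c (to_energy \<psi>) D"
  have rep: "represents ?f (mu_sem H \<psi> (\<lambda>_. {}))"
    using assms(2,3,7) by (intro represents_mu_sem) (auto simp: mu_closed_def)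
  \<comment> \<open>The matching property is applied to \<open>H\<close> rather than to
    \<open>G\<close>: it has the same condition over more variables, so here the formula computes a
    region that already accounts for energy.\<close>
  have region: "mu_sem H \<psi> (\<lambda>_. {}) = env_winning_region H"
  proof -
    have "win_cond H = \<phi>" "mu_lits \<psi> \<subseteq> vars H"
      using assms(6,7) unfolding win_cond_H vars_H by auto
    then show ?thesis using assms(4) gs_H unfolding env_matches_def by blast
  qed
  have s: "s \<subseteq> vars G" using assms(8) unfolding states_def by simp
  \<comment> \<open>Credit \<open>n\<close> in \<open>G\<close> corresponds to the start state
    \<open>s \<union> enc n\<close> of \<open>H\<close>, so the winning credits are those with
    \<open>n \<le> c - ?f s\<close>.\<close>
  have wins: "env_wins_energy G s (enat c) n \<longleftrightarrow> ?f s + enat n \<le> enat c" if "n \<le> c" for n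
  proof -
    note sn = encoded_state[OF s that]
    have mem: "s \<union> enc n \<in> states H" using sn(3) states_H_iff by blast
    then have "s \<union> enc n \<in> env_winning_region H \<longleftrightarrow> ?f s + enat n \<le> enat c"
      using rep sn unfolding region represents_def by auto
    then show ?thesis
      using env_wins_energy_if_env_wins_H[OF _ assms(8) that]
        env_wins_H_if_env_wins_energy[OF _ mem] unfolding sn(1,2) by blast
  qed
  have "?f s \<in> energies c" using rep assms(8) unfolding represents_def by blast
  then consider (inf) "?f s = \<infinity>" | (fin) k where "?f s = enat k" "k \<le> c"
    unfolding energies_def by (cases "?f s") auto
  then show ?thesis
  proof cases
    case inf
    then show ?thesis using wins by auto
  next
    case fin
    then have "env_wins_energy G s (enat c) n \<longleftrightarrow> n \<le> c - k" if "n \<le> c" for n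
      using wins[OF that] by auto
    then have "?f s + enat (c - k) = enat c \<and> env_wins_energy G s (enat c) (c - k) \<and>
        (\<forall>c\<^sub>0 \<le> c. env_wins_energy G s (enat c) c\<^sub>0 \<longrightarrow> c\<^sub>0 \<le> c - k)"
      using fin by simp
    then show ?thesis using fin(1) by (metis enat.distinct(1))
  qed
qed

end
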